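(* Let $R$ be a principal ideal domain with field of fractions $F$, let $r,n$ be integers with $0<r<n$, let $f=n-r$, let $p\in R$ be a prime, and let $K\in M_{r,f}(R)$. Let $N=\{X\in R^n : JX=0\}$, where $J=(pI_r\ \ K)\in M_{r,n}(R)$. For $1\le j\le f$ let $V(j)\in F^n$ be the column vector whose first $r$ entries are $-K_{1,j}/p,\dots,-K_{r,j}/p$, whose $(r+j)$-th entry is $1$, and whose other entries are $0$. Let $\overline{K}$ be the reduction of $K$ modulo $p$, let $s$ be the rank of $\overline{K}$ over the field $R/Rp$, and let $H\in M_{r,f}(R)$ be a matrix whose reduction $\overline{H}$ modulo $p$ is the reduced row echelon form of $\overline{K}$. Assume that the leading columns (the columns containing the leading ones) of $\overline{H}$ are columns $1,\dots,s$. Consider the vectors $$z_1=pV(1),\ \dots,\ z_s=pV(s),$$ and, if $s<f$, also the vectors $$z_{s+i}=-\bigl(H_{1,s+i}V(1)+\cdots+H_{s,s+i}V(s)\bigr)+V(s+i),\quad 1\le i\le f-s.$$ Then $\{z_1,\dots,z_f\}$ is an $R$-basis of $N$ (if $s=0$, $\{z_1,\dots,z_f\}$ is simply $\{V(1),\dots,V(f)\}$).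
   Context: $N$ is a free $R$-module of rank $f$. In the source, $(pI_r\ \ K)$ consists of the first $r$ rows of a reduced matrix $Z=\begin{pmatrix} pI_r&K\\0&0\end{pmatrix}$ associated to a matrix $A\in M_{m,n}(R)$ of rank $r$, i.e. $LA\Sigma=Z$ with $L\in\mathrm{GL}_m(F)$ and $\Sigma$ a permutation matrix, so that the nullspace of $A$ in $R^n$ is $\Sigma N$. *)

theory Defs
  imports
    "Jordan_Normal_Form.VS_Connect"
    "HOL-Algebra.QuotRing"
    "HOL-Algebra.Ring_Divisibility"
    "HOL-Computational_Algebra.Polynomial_Factorial"
begin

hide_const (open) Multiset.mult Polynomial.smult

text \<open>
  The ring \<open>R\<close> is a type \<open>'a\<close> of class \<^class>\<open>idom\<close>, its field of fractions is \<open>'a fract\<close>, and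
  \<^term>\<open>to_fract\<close> is the inclusion of \<open>R\<close> in it. The quotient \<open>R/Rp\<close> depends on the element \<open>p\<close>, so
  it is not a type but a ring record with carrier in \<open>'a set\<close>; linear algebra over it is therefore
  developed for matrices with entries in the carrier of a ring record. Rows, columns and vectors
  are indexed from 0.
\<close>

section \<open>Matrices over a ring record\<close>

definition mats_over :: "('b, 'c) ring_scheme \<Rightarrow> nat \<Rightarrow> nat \<Rightarrow> 'b mat set" where
  "mats_over Q m n = {A \<in> carrier_mat m n. elements_mat A \<subseteq> carrier Q}"

definition mult_over :: "('b, 'c) ring_scheme \<Rightarrow> 'b mat \<Rightarrow> 'b mat \<Rightarrow> 'b mat" where
  "mult_over Q A B = mat (dim_row A) (dim_col B)
     (\<lambda>(i, j). \<Oplus>\<^bsub>Q\<^esub>k\<in>{..<dim_col A}. A $$ (i, k) \<otimes>\<^bsub>Q\<^esub> B $$ (k, j))"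

definition one_over :: "('b, 'c) ring_scheme \<Rightarrow> nat \<Rightarrow> 'b mat" where
  "one_over Q m = mat m m (\<lambda>(i, j). if i = j then \<one>\<^bsub>Q\<^esub> else \<zero>\<^bsub>Q\<^esub>)"

definition GL_over :: "('b, 'c) ring_scheme \<Rightarrow> nat \<Rightarrow> 'b mat set" where
  "GL_over Q m = {P \<in> mats_over Q m m. \<exists>P' \<in> mats_over Q m m.
     mult_over Q P P' = one_over Q m \<and> mult_over Q P' P = one_over Q m}"

definition row_equivalent_over :: "('b, 'c) ring_scheme \<Rightarrow> 'b mat \<Rightarrow> 'b mat \<Rightarrow> bool" where
  "row_equivalent_over Q A B \<longleftrightarrow> (\<exists>P \<in> GL_over Q (dim_row A). B = mult_over Q P A)"

definition leading_entry :: "('b, 'c) ring_scheme \<Rightarrow> 'b mat \<Rightarrow> nat \<Rightarrow> nat \<Rightarrow> bool" where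
  "leading_entry Q A i j \<longleftrightarrow> i < dim_row A \<and> j < dim_col A \<and>
     A $$ (i, j) \<noteq> \<zero>\<^bsub>Q\<^esub> \<and> (\<forall>j'<j. A $$ (i, j') = \<zero>\<^bsub>Q\<^esub>)"

definition leading_columns :: "('b, 'c) ring_scheme \<Rightarrow> 'b mat \<Rightarrow> nat set" where
  "leading_columns Q A = {j. \<exists>i. leading_entry Q A i j}"

text \<open>
  The four conditions: zero rows are at the bottom; leading entries move strictly to the right;
  leading entries are 1; a leading entry is the only nonzero entry of its column.
\<close>
definition reduced_row_echelon :: "('b, 'c) ring_scheme \<Rightarrow> 'b mat \<Rightarrow> bool" where
  "reduced_row_echelon Q A \<longleftrightarrow>
     (\<forall>i i' j'. i < i' \<and> leading_entry Q A i' j' \<longrightarrow> (\<exists>j. leading_entry Q A i j)) \<and>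
     (\<forall>i j i' j'. i < i' \<and> leading_entry Q A i j \<and> leading_entry Q A i' j' \<longrightarrow> j < j') \<and>
     (\<forall>i j. leading_entry Q A i j \<longrightarrow> A $$ (i, j) = \<one>\<^bsub>Q\<^esub>) \<and>
     (\<forall>i j i'. leading_entry Q A i j \<and> i' < dim_row A \<and> i' \<noteq> i \<longrightarrow> A $$ (i', j) = \<zero>\<^bsub>Q\<^esub>)"

definition is_rref_of :: "('b, 'c) ring_scheme \<Rightarrow> 'b mat \<Rightarrow> 'b mat \<Rightarrow> bool" where
  "is_rref_of Q B A \<longleftrightarrow> reduced_row_echelon Q B \<and> row_equivalent_over Q A B"

text \<open>
  The rank is the dimension of the column space, a subspace of the space of functions from the
  row indices to \<open>Q\<close>.
\<close>
definition rank_over :: "('b, 'c) ring_scheme \<Rightarrow> 'b mat \<Rightarrow> nat" where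
  "rank_over Q A =
     (let W = ring.func_space Q {..<dim_row A};
          C = (\<lambda>j. restrict (\<lambda>i. A $$ (i, j)) {..<dim_row A}) ` {..<dim_col A}
      in vectorspace.dim Q (W\<lparr>carrier := LinearCombinations.module.span Q W C\<rparr>))"

section \<open>Reduction modulo an element\<close>

definition quot_by :: "'a::idom \<Rightarrow> 'a set ring" where
  "quot_by p = class_ring Quot (PIdl\<^bsub>class_ring\<^esub> p)"

definition reduce_mat :: "'a::idom \<Rightarrow> 'a mat \<Rightarrow> 'a set mat" where
  "reduce_mat p = map_mat (\<lambda>a. PIdl\<^bsub>class_ring\<^esub> p +>\<^bsub>class_ring\<^esub> a)"

section \<open>The R-module \<open>F\<^sup>n\<close> and bases of its submodules\<close>

text \<open>The \<open>mult\<close> and \<open>one\<close> fields of the record play no role in a module.\<close>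
definition fract_module :: "nat \<Rightarrow> ('a::idom, 'a fract vec) module" where
  "fract_module n = \<lparr>carrier = carrier_vec n, mult = undefined, one = undefined,
     zero = 0\<^sub>v n, add = (+), smult = (\<lambda>a v. to_fract a \<cdot>\<^sub>v v)\<rparr>"

definition basis_of_submodule ::
  "('a, 'b) ring_scheme \<Rightarrow> ('a, 'v, 'c) module_scheme \<Rightarrow> 'v set \<Rightarrow> 'i set \<Rightarrow> ('i \<Rightarrow> 'v) \<Rightarrow> bool" where
  "basis_of_submodule R M N I z \<longleftrightarrow>
     LinearCombinations.submodule R N M \<and> z ` I \<subseteq> N \<and> inj_on z I \<and>
     \<not> LinearCombinations.module.lin_dep R M (z ` I) \<and>
     LinearCombinations.module.span R M (z ` I) = N"

section \<open>The null space \<open>N\<close> and the vectors \<open>V(j)\<close> and \<open>z\<^sub>j\<close>\<close>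

definition J_mat :: "nat \<Rightarrow> nat \<Rightarrow> 'a::idom \<Rightarrow> 'a mat \<Rightarrow> 'a mat" where
  "J_mat r n p K = mat r n
     (\<lambda>(i, j). if j < r then (p \<cdot>\<^sub>m 1\<^sub>m r) $$ (i, j) else K $$ (i, j - r))"

definition null_space :: "nat \<Rightarrow> nat \<Rightarrow> 'a::idom \<Rightarrow> 'a mat \<Rightarrow> 'a vec set" where
  "null_space r n p K = {X \<in> carrier_vec n. J_mat r n p K *\<^sub>v X = 0\<^sub>v r}"

definition V_vec :: "nat \<Rightarrow> nat \<Rightarrow> 'a::idom \<Rightarrow> 'a mat \<Rightarrow> nat \<Rightarrow> 'a fract vec" where
  "V_vec r n p K j = vec n (\<lambda>i.
     if i < r then - (to_fract (K $$ (i, j)) / to_fract p)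
     else if i = r + j then 1 else 0)"

definition z_vec ::
  "nat \<Rightarrow> nat \<Rightarrow> 'a::idom \<Rightarrow> 'a mat \<Rightarrow> 'a mat \<Rightarrow> nat \<Rightarrow> nat \<Rightarrow> 'a fract vec" where
  "z_vec r n p K H s j =
     (if j < s then to_fract p \<cdot>\<^sub>v V_vec r n p K j
      else - finsum_vec TYPE('a fract) n (\<lambda>l. to_fract (H $$ (l, j)) \<cdot>\<^sub>v V_vec r n p K l) {..<s}
           + V_vec r n p K j)"

end

theory Submission
  imports Defs
begin

text \<open>
  A vector of \<open>F\<^sup>n\<close> with \<open>J X = 0\<close> is \<open>\<Sum>\<^sub>k x\<^sub>k V(k)\<close> for its last \<open>f\<close> coordinates \<open>x\<close>, and it lies
  in \<open>R\<^sup>n\<close> iff \<open>x\<close> does and \<open>K x\<close> vanishes modulo \<open>p\<close>. As \<open>H\<close> is row equivalent to \<open>K\<close> modulo \<open>p\<close>, this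
  says that \<open>H x\<close> vanishes modulo \<open>p\<close>, and by the shape of the reduced row echelon form it amounts
  to \<open>p\<close> dividing \<open>x\<^sub>l + \<Sum>\<^sub>j H\<^sub>l\<^sub>j x\<^sub>j\<close> (\<open>j\<close> ranging over the non-leading columns) for each
  leading column \<open>l\<close>. Hence the solutions \<open>x\<close> are obtained, each exactly once, by choosing the
  non-leading coordinates and the quotients by \<open>p\<close> freely; these parameters are the coefficients
  with respect to \<open>z\<^sub>1, \<dots>, z\<^sub>f\<close>.
\<close>

section \<open>Bases of submodules\<close>

lemma (in Module.module) finsum_smult_unit:
  assumes "finite I" "z \<in> I \<rightarrow> carrier M" "i \<in> I"
  shows "(\<Oplus>\<^bsub>M\<^esub>j\<in>I. (if i = j then \<one> else \<zero>) \<odot>\<^bsub>M\<^esub> z j) = z i"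
proof -
  have "(\<Oplus>\<^bsub>M\<^esub>j\<in>I. (if i = j then \<one> else \<zero>) \<odot>\<^bsub>M\<^esub> z j)
      = (\<Oplus>\<^bsub>M\<^esub>j\<in>I. if i = j then z j else \<zero>\<^bsub>M\<^esub>)"
    using assms by (intro M.finsum_cong') (auto simp: Pi_def)
  also have "\<dots> = z i"
    using assms by (intro M.add.finprod_singleton) auto
  finally show ?thesis .
qed

lemma (in Module.module) basis_of_submodule_if_unique_coeffs:
  assumes fin: "finite I" and zM: "z \<in> I \<rightarrow> carrier M" and nontriv: "\<one> \<noteq> \<zero>"
    and unique: "\<And>a b i. a \<in> I \<rightarrow> carrier R \<Longrightarrow> b \<in> I \<rightarrow> carrier R \<Longrightarrow>
      (\<Oplus>\<^bsub>M\<^esub>j\<in>I. a j \<odot>\<^bsub>M\<^esub> z j) = (\<Oplus>\<^bsub>M\<^esub>j\<in>I. b j \<odot>\<^bsub>M\<^esub> z j) \<Longrightarrow> i \<in> I \<Longrightarrow> a i = b i"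
    and N: "N = {\<Oplus>\<^bsub>M\<^esub>j\<in>I. a j \<odot>\<^bsub>M\<^esub> z j |a. a \<in> I \<rightarrow> carrier R}"
  shows "basis_of_submodule R M N I z"
proof -
  have inj: "inj_on z I"
  proof (rule inj_onI, rule ccontr)
    fix i k assume ik: "i \<in> I" "k \<in> I" "z i = z k" "i \<noteq> k"
    \<comment> \<open>The unit families at \<open>i\<close> and \<open>k\<close> have the sums
      \<open>z i\<close> and \<open>z k\<close>, which are equal; uniqueness then compares them at
      the index \<open>i\<close>.\<close>
    have "(if i = i then \<one> else \<zero>) = (if k = i then \<one> else \<zero>)"
      by (rule unique) (use ik in \<open>auto simp: finsum_smult_unit[OF fin zM]\<close>)
    with ik nontriv show False by simp
  qed
  have sub: "z ` I \<subseteq> carrier M" using zM by auto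
  have lc: "lincomb a (z ` I) = (\<Oplus>\<^bsub>M\<^esub>j\<in>I. a (z j) \<odot>\<^bsub>M\<^esub> z j)" if "a \<in> z ` I \<rightarrow> carrier R" for a
    unfolding lincomb_def by (rule M.finsum_reindex) (use that zM inj in auto)
  have indep: "lin_indpt (z ` I)"
  proof (rule finite_lin_indpt2)
    fix a assume a: "a \<in> z ` I \<rightarrow> carrier R" "lincomb a (z ` I) = \<zero>\<^bsub>M\<^esub>"
    have zero: "(\<Oplus>\<^bsub>M\<^esub>j\<in>I. \<zero> \<odot>\<^bsub>M\<^esub> z j) = \<zero>\<^bsub>M\<^esub>"
      using zM by (intro M.add.finprod_one_eqI) (auto simp: Pi_iff intro: smult_l_null)
    have "a (z i) = \<zero>" if "i \<in> I" for i
      using unique[of "\<lambda>i. a (z i)" "\<lambda>_. \<zero>" i] lc[OF a(1)] a that zero by auto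
    then show "\<forall>v\<in>z ` I. a v = \<zero>" by auto
  qed (use fin sub in auto)
  have span: "span (z ` I) = N"
  proof -
    have "span (z ` I) = {lincomb a (z ` I) |a. a \<in> z ` I \<rightarrow> carrier R}"
      by (rule finite_span) (use fin sub in auto)
    also have "\<dots> = N"
    proof (intro equalityI subsetI)
      fix v assume "v \<in> {lincomb a (z ` I) |a. a \<in> z ` I \<rightarrow> carrier R}"
      then obtain a where "a \<in> z ` I \<rightarrow> carrier R" "v = lincomb a (z ` I)" by auto
      then show "v \<in> N" unfolding N by (auto simp: lc intro!: exI[of _ "\<lambda>i. a (z i)"])
    next
      fix v assume "v \<in> N"
      then obtain a where a: "a \<in> I \<rightarrow> carrier R" "v = (\<Oplus>\<^bsub>M\<^esub>j\<in>I. a j \<odot>\<^bsub>M\<^esub> z j)"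
        unfolding N by auto
      \<comment> \<open>Injectivity of \<open>z\<close> allows coefficients on indices to be carried
        over to the vectors themselves.\<close>
      define b where "b = (\<lambda>v. a (the_inv_into I z v))"
      have bz: "b (z i) = a i" if "i \<in> I" for i
        using that inj by (simp add: b_def the_inv_into_f_f)
      then have bR: "b \<in> z ` I \<rightarrow> carrier R" using a(1) by auto
      have "v = lincomb b (z ` I)"
        unfolding a(2) lc[OF bR] using a(1) zM bz by (intro M.finsum_cong') (auto simp: Pi_iff)
      with bR show "v \<in> {lincomb a (z ` I) |a. a \<in> z ` I \<rightarrow> carrier R}" by auto
    qed
    finally show ?thesis .
  qed
  have "submodule R N M" using span_is_submodule[OF sub] unfolding span .
  moreover have "z ` I \<subseteq> N" using in_own_span[OF sub] unfolding span .
  ultimately show ?thesis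
    unfolding basis_of_submodule_def using inj indep span by blast
qed

lemma module_fract_module: "Module.module (class_ring :: 'a::idom ring) (fract_module n)"
  by (rule module_criteria)
    (auto simp: fract_module_def class_cring.cring_axioms smult_smult_assoc add_smult_distrib_vec
      smult_add_distrib_vec assoc_add_vec comm_add_vec intro!: bexI[of _ "- _"])

text \<open>Restricting the scalars from F to R does not change the underlying additive monoid, and
  finite sums depend on nothing else.\<close>

lemma finsum_fract_module: "finsum (fract_module n) = finsum_vec TYPE('a::idom fract) n"
  unfolding finsum_def finsum_vec_def
  by (intro ext) (simp add: finprod_def fract_module_def monoid_vec_def)

section \<open>Reduced row echelon form with leading columns in front\<close>

lemma leading_entry_column_unique:
  "leading_entry Q A i j \<Longrightarrow> leading_entry Q A i j' \<Longrightarrow> j = j'"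
  unfolding leading_entry_def by (metis linorder_neqE_nat)

lemma nonzero_row_has_leading_entry:
  assumes "i < dim_row A" "j < dim_col A" "A $$ (i, j) \<noteq> \<zero>\<^bsub>Q\<^esub>"
  obtains j' where "leading_entry Q A i j'"
proof -
  let ?P = "\<lambda>j. A $$ (i, j) \<noteq> \<zero>\<^bsub>Q\<^esub>"
  have "leading_entry Q A i (LEAST j. ?P j)"
    unfolding leading_entry_def using assms LeastI[of ?P, OF assms(3)] Least_le[of ?P, OF assms(3)]
    by (auto dest: not_less_Least)
  then show thesis by (rule that)
qed

context
  fixes Q :: "('b, 'c) ring_scheme" and A :: "'b mat" and s :: nat
  assumes rref: "reduced_row_echelon Q A" and cols: "leading_columns Q A = {..<s}"
begin

lemma rref_no_zero_row_above:
  "i < i' \<Longrightarrow> leading_entry Q A i' j' \<Longrightarrow> \<exists>j. leading_entry Q A i j"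
  using rref unfolding reduced_row_echelon_def by blast

lemma rref_leading_less:
  "i < i' \<Longrightarrow> leading_entry Q A i j \<Longrightarrow> leading_entry Q A i' j' \<Longrightarrow> j < j'"
  using rref unfolding reduced_row_echelon_def by blast

text \<open>Let row \<open>i'\<close> lead in column \<open>i\<close>. If \<open>i' < i\<close>,
  that row already leads in column \<open>i'\<close> by induction. If \<open>i < i'\<close>, row
  \<open>i\<close> leads in some column \<open>j < i\<close>, where row \<open>j\<close> already
  leads by induction. Both are impossible.\<close>

lemma leading_entry_diag: "i < s \<Longrightarrow> leading_entry Q A i i"
proof (induction i rule: less_induct)
  case (less i)
  obtain i' where i': "leading_entry Q A i' i"
    using less.prems cols unfolding leading_columns_def by blast
  have "\<not> i' < i"
    using leading_entry_column_unique[OF i'] less.IH less.prems by force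
  moreover have "\<not> i < i'"
  proof
    assume "i < i'"
    then obtain j where j: "leading_entry Q A i j" using rref_no_zero_row_above i' by blast
    then have "j < i" using rref_leading_less \<open>i < i'\<close> i' by blast
    then have "leading_entry Q A j j" using less by simp
    then show False using rref_leading_less[OF \<open>j < i\<close> _ j] by blast
  qed
  ultimately show ?case using i' by (metis linorder_neqE_nat)
qed

text \<open>A nonzero row would lead in some column \<open>j' < s\<close>, but row
  \<open>j'\<close>, which lies above it, already leads there.\<close>

lemma rref_zero_row:
  assumes "s \<le> i" "i < dim_row A" "j < dim_col A"
  shows "A $$ (i, j) = \<zero>\<^bsub>Q\<^esub>"
proof (rule ccontr)
  assume "A $$ (i, j) \<noteq> \<zero>\<^bsub>Q\<^esub>"
  then obtain j' where j': "leading_entry Q A i j'"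
    using nonzero_row_has_leading_entry assms by blast
  then have "j' < s" using cols unfolding leading_columns_def by blast
  then show False
    using rref_leading_less[OF _ leading_entry_diag j', of j'] assms by simp
qed

lemma rref_pivot_column:
  assumes "j < s" "i < dim_row A"
  shows "A $$ (i, j) = (if i = j then \<one>\<^bsub>Q\<^esub> else \<zero>\<^bsub>Q\<^esub>)"
  using rref leading_entry_diag[OF assms(1)] assms unfolding reduced_row_echelon_def by auto

end

section \<open>Row equivalence modulo an element\<close>

lemma quot_by_hom:
  fixes p :: "'a::idom"
  shows "ring_hom_cring class_ring (quot_by p) ((+>\<^bsub>class_ring\<^esub>) (PIdl\<^bsub>class_ring\<^esub> p))"
  unfolding quot_by_def
  by (intro ideal.rcos_ring_hom_cring cring.cgenideal_ideal class_cring.cring_axioms) simp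

text \<open>The bridge from R/Rp to R: equations between cosets become divisibility statements, so
  later arguments can stay inside R.\<close>

lemma coset_eq_iff_dvd_diff:
  fixes p a b :: "'a::idom"
  shows "PIdl\<^bsub>class_ring\<^esub> p +>\<^bsub>class_ring\<^esub> a = PIdl\<^bsub>class_ring\<^esub> p +>\<^bsub>class_ring\<^esub> b \<longleftrightarrow> p dvd a - b"
proof -
  have "a - b \<in> PIdl\<^bsub>class_ring\<^esub> p \<longleftrightarrow> p dvd a - b"
    by (auto simp: cgenideal_def dvd_def mult.commute)
  moreover have "ideal (PIdl\<^bsub>class_ring\<^esub> p) class_ring"
    by (intro cring.cgenideal_ideal class_cring.cring_axioms) simp
  ultimately show ?thesis
    using ring.quotient_eq_iff_same_a_r_cos[OF class_ring.ring_axioms, of "PIdl\<^bsub>class_ring\<^esub> p" a b]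
    by (simp add: class_ring_simps)
qed

lemma carrier_quot_by_cosetE:
  fixes p :: "'a::idom"
  assumes "X \<in> carrier (quot_by p)"
  obtains a where "X = PIdl\<^bsub>class_ring\<^esub> p +>\<^bsub>class_ring\<^esub> a"
  using assms unfolding quot_by_def FactRing_def A_RCOSETS_def' by auto

text \<open>A representative is chosen for each entry. The lift of an invertible matrix over R/Rp
  may fail to be invertible over R.\<close>

lemma mats_over_quot_by_lift:
  fixes p :: "'a::idom"
  assumes "P \<in> mats_over (quot_by p) m n"
  obtains q where "q \<in> carrier_mat m n" "P = reduce_mat p q"
proof -
  have "\<exists>a. i < m \<longrightarrow> j < n \<longrightarrow> P $$ (i, j) = PIdl\<^bsub>class_ring\<^esub> p +>\<^bsub>class_ring\<^esub> a" for i j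
    using assms unfolding mats_over_def by (metis (no_types, lifting) carrier_matD carrier_quot_by_cosetE
        elements_matI mem_Collect_eq subsetD)
  then obtain q where "\<And>i j. i < m \<Longrightarrow> j < n \<Longrightarrow> P $$ (i, j) = PIdl\<^bsub>class_ring\<^esub> p +>\<^bsub>class_ring\<^esub> q i j"
    by metis
  then have "P = reduce_mat p (mat m n (\<lambda>(i, j). q i j))"
    using assms by (intro eq_matI) (auto simp: mats_over_def reduce_mat_def)
  then show thesis by (rule that[rotated]) simp
qed

lemma mult_over_reduce_mat:
  fixes p :: "'a::idom"
  assumes "A \<in> carrier_mat m k" "B \<in> carrier_mat k n"
  shows "mult_over (quot_by p) (reduce_mat p A) (reduce_mat p B) = reduce_mat p (A * B)"
proof (rule eq_matI)
  interpret h: ring_hom_cring class_ring "quot_by p" "(+>\<^bsub>class_ring\<^esub>) (PIdl\<^bsub>class_ring\<^esub> p)"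
    by (rule quot_by_hom)
  let ?h = "(+>\<^bsub>class_ring\<^esub>) (PIdl\<^bsub>class_ring\<^esub> p)"
  fix i j assume "i < dim_row (reduce_mat p (A * B))" "j < dim_col (reduce_mat p (A * B))"
  then have ij: "i < m" "j < n" using assms by (auto simp: reduce_mat_def)
  have "mult_over (quot_by p) (reduce_mat p A) (reduce_mat p B) $$ (i, j)
      = (\<Oplus>\<^bsub>quot_by p\<^esub>l\<in>{..<k}. reduce_mat p A $$ (i, l) \<otimes>\<^bsub>quot_by p\<^esub> reduce_mat p B $$ (l, j))"
    using assms ij by (simp add: mult_over_def reduce_mat_def)
  also have "\<dots> = (\<Oplus>\<^bsub>quot_by p\<^esub>l\<in>{..<k}. ?h (A $$ (i, l) * B $$ (l, j)))"
  proof (rule h.S.finsum_cong')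
    show "(\<lambda>l. ?h (A $$ (i, l) * B $$ (l, j))) \<in> {..<k} \<rightarrow> carrier (quot_by p)"
      using h.hom_closed by simp
    fix l assume "l \<in> {..<k}"
    then show "reduce_mat p A $$ (i, l) \<otimes>\<^bsub>quot_by p\<^esub> reduce_mat p B $$ (l, j) = ?h (A $$ (i, l) * B $$ (l, j))"
      using assms ij h.hom_mult[of "A $$ (i, l)" "B $$ (l, j)"] by (simp add: reduce_mat_def)
  qed simp
  also have "\<dots> = ?h (\<Sum>l<k. A $$ (i, l) * B $$ (l, j))"
    using h.hom_finsum[of "\<lambda>l. A $$ (i, l) * B $$ (l, j)" "{..<k}"]
    by (simp add: class_ring_simps o_def)
  also have "\<dots> = reduce_mat p (A * B) $$ (i, j)"
    using assms ij by (simp add: reduce_mat_def scalar_prod_def lessThan_atLeast0)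
  finally show "mult_over (quot_by p) (reduce_mat p A) (reduce_mat p B) $$ (i, j)
      = reduce_mat p (A * B) $$ (i, j)" .
qed (auto simp: mult_over_def reduce_mat_def)

lemma reduce_mat_eq_iff:
  fixes p :: "'a::idom"
  assumes "A \<in> carrier_mat m n" "B \<in> carrier_mat m n"
  shows "reduce_mat p A = reduce_mat p B \<longleftrightarrow> (\<forall>i<m. \<forall>j<n. p dvd A $$ (i, j) - B $$ (i, j))"
  using assms by (auto simp: reduce_mat_def mat_eq_iff coset_eq_iff_dvd_diff)

lemma one_over_quot_by:
  fixes p :: "'a::idom"
  shows "one_over (quot_by p) m = reduce_mat p (1\<^sub>m m)"
proof -
  interpret h: ring_hom_cring class_ring "quot_by p" "(+>\<^bsub>class_ring\<^esub>) (PIdl\<^bsub>class_ring\<^esub> p)"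
    by (rule quot_by_hom)
  show ?thesis
    using h.hom_one h.hom_zero by (intro eq_matI) (auto simp: one_over_def reduce_mat_def)
qed

text \<open>The transforming matrix and its inverse over R/Rp are lifted separately, since the lifts
  are inverse to each other only modulo \<open>p\<close>.\<close>

lemma row_equivalent_reduce_matE:
  fixes p :: "'a::idom"
  assumes "row_equivalent_over (quot_by p) (reduce_mat p A) (reduce_mat p B)"
    and "A \<in> carrier_mat m n" "B \<in> carrier_mat m n"
  obtains q q' where "q \<in> carrier_mat m m" "q' \<in> carrier_mat m m"
    "reduce_mat p B = reduce_mat p (q * A)" "reduce_mat p A = reduce_mat p (q' * B)"
proof -
  obtain P P' where P: "P \<in> mats_over (quot_by p) m m" "P' \<in> mats_over (quot_by p) m m"
    "mult_over (quot_by p) P' P = one_over (quot_by p) m"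
    "reduce_mat p B = mult_over (quot_by p) P (reduce_mat p A)"
    using assms unfolding row_equivalent_over_def GL_over_def by (auto simp: reduce_mat_def)
  obtain q where q: "q \<in> carrier_mat m m" "P = reduce_mat p q"
    using P(1) by (rule mats_over_quot_by_lift)
  obtain q' where q': "q' \<in> carrier_mat m m" "P' = reduce_mat p q'"
    using P(2) by (rule mats_over_quot_by_lift)
  have B: "reduce_mat p B = reduce_mat p (q * A)"
    using P(4) mult_over_reduce_mat[OF q(1) assms(2)] q(2) by simp
  have "reduce_mat p (q' * q) = reduce_mat p (1\<^sub>m m)"
    using P(3) mult_over_reduce_mat[OF q'(1) q(1), of p] q(2) q'(2) one_over_quot_by by metis
  then have "mult_over (quot_by p) (reduce_mat p (1\<^sub>m m)) (reduce_mat p A)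
      = mult_over (quot_by p) (reduce_mat p (q' * q)) (reduce_mat p A)"
    by simp
  \<comment> \<open>Modulo \<open>p\<close>, \<open>A\<close> is congruent to
    \<open>q' * q * A\<close> and hence to \<open>q' * B\<close>.\<close>
  then have "reduce_mat p (1\<^sub>m m * A) = reduce_mat p ((q' * q) * A)"
    using assms(2) q(1) q'(1)
    by (simp add: mult_over_reduce_mat[of _ m m _ n])
  also have "(q' * q) * A = q' * (q * A)"
    using q(1) q'(1) assms(2) by simp
  also have "reduce_mat p (q' * (q * A)) = reduce_mat p (q' * B)"
    using B mult_over_reduce_mat[OF q'(1), of "q * A" n p] mult_over_reduce_mat[OF q'(1), of B n p]
      assms q(1) by simp
  finally have "reduce_mat p A = reduce_mat p (q' * B)" using assms(2) by simp
  with q(1) q'(1) B show thesis by (rule that)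
qed

text \<open>Modulo \<open>p\<close>, \<open>B x\<close> agrees with \<open>q (A x)\<close>, whose
  entries are combinations of the entries of \<open>A x\<close>.\<close>

lemma dvd_mult_mat_vec_if_reduce_mat_eq:
  fixes p :: "'a::idom"
  assumes "A \<in> carrier_mat m n" "B \<in> carrier_mat m n" "q \<in> carrier_mat m m" "x \<in> carrier_vec n"
    and eq: "reduce_mat p B = reduce_mat p (q * A)"
    and dvd: "\<forall>i<m. p dvd (A *\<^sub>v x) $ i" and i: "i < m"
  shows "p dvd (B *\<^sub>v x) $ i"
proof -
  define D where "D = q * A"
  have D: "D \<in> carrier_mat m n" using assms(1,3) by (simp add: D_def)
  have "(B *\<^sub>v x) $ i - (D *\<^sub>v x) $ i = (\<Sum>j<n. (B $$ (i, j) - D $$ (i, j)) * x $ j)"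
    using assms(2,4) i D by (simp add: scalar_prod_def lessThan_atLeast0 sum_subtractf left_diff_distrib)
  also have "p dvd \<dots>"
    using eq[folded D_def] assms(2) i D by (intro dvd_sum dvd_mult2) (simp add: reduce_mat_eq_iff)
  finally have diff: "p dvd (B *\<^sub>v x) $ i - (D *\<^sub>v x) $ i" .
  have "(D *\<^sub>v x) $ i = (q *\<^sub>v (A *\<^sub>v x)) $ i"
    by (simp only: D_def assoc_mult_mat_vec[OF assms(3,1,4)])
  also have "\<dots> = (\<Sum>k<m. q $$ (i, k) * (A *\<^sub>v x) $ k)"
    using assms(1,3) i by (simp add: scalar_prod_def[of _ "A *\<^sub>v x"] lessThan_atLeast0)
  also have "p dvd \<dots>"
    using dvd by (intro dvd_sum dvd_mult) auto
  finally show ?thesis using dvd_add[OF diff] by fastforce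
qed

text \<open>Row equivalent matrices over R/Rp have the same kernel, stated through representatives
  in R. This replaces \<open>K\<close> by \<open>H\<close> in the integrality condition.\<close>

lemma row_equivalent_kernel_iff:
  fixes p :: "'a::idom"
  assumes "row_equivalent_over (quot_by p) (reduce_mat p A) (reduce_mat p B)"
    and "A \<in> carrier_mat m n" "B \<in> carrier_mat m n" "x \<in> carrier_vec n"
  shows "(\<forall>i<m. p dvd (A *\<^sub>v x) $ i) \<longleftrightarrow> (\<forall>i<m. p dvd (B *\<^sub>v x) $ i)"
proof -
  obtain q q' where "q \<in> carrier_mat m m" "q' \<in> carrier_mat m m"
    "reduce_mat p B = reduce_mat p (q * A)" "reduce_mat p A = reduce_mat p (q' * B)"
    by (rule row_equivalent_reduce_matE[OF assms(1-3)])
  then show ?thesis using dvd_mult_mat_vec_if_reduce_mat_eq assms by blast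
qed

section \<open>The null space and its generators\<close>

text \<open>The vector of \<open>F\<^sup>n\<close> with \<open>J X = 0\<close> whose last \<open>f\<close> coordinates are \<open>x\<close>.\<close>
definition null_vec :: "nat \<Rightarrow> nat \<Rightarrow> 'a::idom \<Rightarrow> 'a mat \<Rightarrow> 'a vec \<Rightarrow> 'a fract vec" where
  "null_vec r n p K x = vec n (\<lambda>i. if i < r then - (to_fract ((K *\<^sub>v x) $ i) / to_fract p)
     else to_fract (x $ (i - r)))"

text \<open>The columns are the coordinate vectors of the \<open>z\<^sub>j\<close> with respect to the \<open>V(j)\<close>.\<close>
definition coeff_mat :: "nat \<Rightarrow> 'a::idom \<Rightarrow> 'a mat \<Rightarrow> nat \<Rightarrow> 'a mat" where
  "coeff_mat f p H s = mat f f (\<lambda>(k, j).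
     if j < s then if k = j then p else 0
     else if k < s then - H $$ (k, j) else if k = j then 1 else 0)"

lemma to_fract_sum: "to_fract (sum g I) = (\<Sum>i\<in>I. to_fract (g i))"
  by (induction I rule: infinite_finite_induct) auto

lemma sum_lessThan_add:
  fixes g :: "nat \<Rightarrow> 'b::comm_monoid_add"
  shows "(\<Sum>j<m + k. g j) = (\<Sum>j<m. g j) + (\<Sum>j<k. g (m + j))"
  by (induction k) (auto simp: add.assoc)

context
  fixes r n f :: nat and p :: "'a::idom" and K :: "'a mat"
  assumes n: "n = r + f" and p0: "p \<noteq> 0" and K: "K \<in> carrier_mat r f"
begin

lemma null_vec_eq_iff:
  assumes "x \<in> carrier_vec f" "y \<in> carrier_vec f"
  shows "null_vec r n p K x = null_vec r n p K y \<longleftrightarrow> x = y"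
proof
  assume eq: "null_vec r n p K x = null_vec r n p K y"
  have "x $ k = y $ k" if "k < f" for k
    using arg_cong[OF eq, of "\<lambda>v. v $ (r + k)"] that n by (simp add: null_vec_def)
  then show "x = y" using assms by (intro eq_vecI) auto
qed simp

lemma J_mat_mult_vec:
  assumes "X \<in> carrier_vec n" "i < r"
  shows "(J_mat r n p K *\<^sub>v X) $ i = p * X $ i + (K *\<^sub>v vec f (\<lambda>j. X $ (r + j))) $ i"
proof -
  have "(J_mat r n p K *\<^sub>v X) $ i
      = (\<Sum>j<r + f. (if j < r then (p \<cdot>\<^sub>m 1\<^sub>m r) $$ (i, j) else K $$ (i, j - r)) * X $ j)"
    using assms n by (simp add: J_mat_def scalar_prod_def lessThan_atLeast0)
  also have "\<dots> = (\<Sum>j<r. (p \<cdot>\<^sub>m 1\<^sub>m r) $$ (i, j) * X $ j) + (\<Sum>j<f. K $$ (i, j) * X $ (r + j))"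
    unfolding sum_lessThan_add by simp
  also have "(\<Sum>j<r. (p \<cdot>\<^sub>m 1\<^sub>m r) $$ (i, j) * X $ j) = (\<Sum>j<r. if i = j then p * X $ j else 0)"
    using assms by (intro sum.cong) auto
  also have "\<dots> = p * X $ i" using assms by simp
  also have "(\<Sum>j<f. K $$ (i, j) * X $ (r + j)) = (K *\<^sub>v vec f (\<lambda>j. X $ (r + j))) $ i"
    using assms K by (simp add: scalar_prod_def lessThan_atLeast0)
  finally show ?thesis .
qed

text \<open>The equation \<open>J X = 0\<close> says that \<open>p * X $ i\<close> is the negative
  of entry \<open>i\<close> of \<open>K x\<close>, where \<open>x\<close> is the tail of
  \<open>X\<close>. So the tail determines \<open>X\<close>, and the first \<open>r\<close> entries
  lie in R exactly when \<open>p\<close> divides \<open>K x\<close>.\<close>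

lemma image_null_space:
  "map_vec to_fract ` null_space r n p K
    = null_vec r n p K ` {x \<in> carrier_vec f. \<forall>i<r. p dvd (K *\<^sub>v x) $ i}"
proof (intro equalityI subsetI; elim imageE)
  fix v X assume v: "v = map_vec to_fract X" and "X \<in> null_space r n p K"
  then have X: "X \<in> carrier_vec n" and J: "J_mat r n p K *\<^sub>v X = 0\<^sub>v r"
    by (auto simp: null_space_def)
  define x where "x = vec f (\<lambda>j. X $ (r + j))"
  have Kx: "(K *\<^sub>v x) $ i = p * (- X $ i)" if "i < r" for i
    using arg_cong[OF J, of "\<lambda>v. v $ i"] J_mat_mult_vec[OF X that] that
    by (simp add: x_def eq_neg_iff_add_eq_0 add.commute)
  have "v = null_vec r n p K x"
  proof (rule eq_vecI)
    fix i assume "i < dim_vec (null_vec r n p K x)"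
    then have i: "i < n" by (simp add: null_vec_def)
    then have "x $ (i - r) = X $ i" if "\<not> i < r"
    proof -
      have "r + (i - r) = i" "i - r < f" using that i n by linarith+
      then show ?thesis by (simp add: x_def)
    qed
    then show "v $ i = null_vec r n p K x $ i" using i X p0 by (simp add: v null_vec_def Kx)
  qed (use X in \<open>simp add: v null_vec_def\<close>)
  moreover have "x \<in> carrier_vec f" "\<forall>i<r. p dvd (K *\<^sub>v x) $ i"
    using Kx by (auto simp: x_def)
  ultimately show "v \<in> null_vec r n p K ` {x \<in> carrier_vec f. \<forall>i<r. p dvd (K *\<^sub>v x) $ i}" by blast
next
  fix v x assume v: "v = null_vec r n p K x" and "x \<in> {x \<in> carrier_vec f. \<forall>i<r. p dvd (K *\<^sub>v x) $ i}"
  then have x: "x \<in> carrier_vec f" and "\<forall>i<r. \<exists>c. (K *\<^sub>v x) $ i = p * c"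
    by (auto simp: dvd_def)
  then obtain c where c: "\<And>i. i < r \<Longrightarrow> (K *\<^sub>v x) $ i = p * c i" by metis
  \<comment> \<open>The quotients of \<open>K x\<close> by \<open>p\<close>, with sign reversed, are
    the only possible first \<open>r\<close> entries.\<close>
  define X where "X = vec n (\<lambda>i. if i < r then - c i else x $ (i - r))"
  have X: "X \<in> carrier_vec n" by (simp add: X_def)
  have x_eq: "vec f (\<lambda>j. X $ (r + j)) = x"
    using x n by (intro eq_vecI) (auto simp: X_def)
  have "J_mat r n p K *\<^sub>v X = 0\<^sub>v r"
  proof (rule eq_vecI)
    fix i assume "i < dim_vec (0\<^sub>v r :: 'a vec)"
    then show "(J_mat r n p K *\<^sub>v X) $ i = 0\<^sub>v r $ i"
      using J_mat_mult_vec[OF X, of i] n unfolding x_eq by (simp add: c X_def)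
  qed (simp add: J_mat_def)
  moreover have "v = map_vec to_fract X"
    using p0 by (intro eq_vecI) (auto simp: v null_vec_def X_def c)
  ultimately show "v \<in> map_vec to_fract ` null_space r n p K"
    using X unfolding null_space_def by blast
qed

section \<open>Expansion in the vectors V(k) and coordinates of the generators\<close>

lemma null_vec_index:
  assumes "x \<in> carrier_vec f" "i < n"
  shows "null_vec r n p K x $ i = (\<Sum>k<f. to_fract (x $ k) * V_vec r n p K k $ i)"
proof (cases "i < r")
  case True
  then show ?thesis
    using assms K
    by (simp add: null_vec_def V_vec_def scalar_prod_def lessThan_atLeast0 to_fract_sum
        sum_divide_distrib sum_negf mult.commute)
next
  case False
  then have i: "i - r < f" using assms n by linarith
  have "(\<Sum>k<f. to_fract (x $ k) * V_vec r n p K k $ i)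
      = (\<Sum>k<f. if i - r = k then to_fract (x $ k) else 0)"
    using False assms by (intro sum.cong) (auto simp: V_vec_def)
  also have "\<dots> = null_vec r n p K x $ i"
    using False assms i by (simp add: null_vec_def)
  finally show ?thesis by simp
qed

text \<open>Both sides are expanded in the V(k) entry by entry. This reduces questions about the
  generators to the matrix \<open>coeff_mat\<close> over R.\<close>

lemma z_vec_eq_null_vec:
  assumes "j < f" "s \<le> f"
  shows "z_vec r n p K H s j = null_vec r n p K (col (coeff_mat f p H s) j)"
proof (rule eq_vecI)
  show "dim_vec (z_vec r n p K H s j) = dim_vec (null_vec r n p K (col (coeff_mat f p H s) j))"
    by (simp add: z_vec_def null_vec_def V_vec_def)
  fix i assume "i < dim_vec (null_vec r n p K (col (coeff_mat f p H s) j))"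
  then have i: "i < n" by (simp add: null_vec_def)
  let ?V = "\<lambda>k. V_vec r n p K k $ i"
  have rhs: "null_vec r n p K (col (coeff_mat f p H s) j) $ i
      = (\<Sum>k<f. to_fract (coeff_mat f p H s $$ (k, j)) * ?V k)"
    using null_vec_index[of "col (coeff_mat f p H s) j" i] i assms by (simp add: coeff_mat_def)
  show "z_vec r n p K H s j $ i = null_vec r n p K (col (coeff_mat f p H s) j) $ i"
  proof (cases "j < s")
    case True
    have "(\<Sum>k<f. to_fract (coeff_mat f p H s $$ (k, j)) * ?V k)
        = (\<Sum>k<f. if j = k then to_fract p * ?V k else 0)"
      using True assms by (intro sum.cong) (auto simp: coeff_mat_def)
    then show ?thesis unfolding rhs using True assms i by (simp add: z_vec_def V_vec_def)
  next
    case False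
    have V: "V_vec r n p K l \<in> carrier_vec n" for l by (simp add: V_vec_def)
    have "finsum_vec TYPE('a fract) n (\<lambda>l. to_fract (H $$ (l, j)) \<cdot>\<^sub>v V_vec r n p K l) {..<s} $ i
        = (\<Sum>l<s. to_fract (H $$ (l, j)) * ?V l)"
      using i V by (subst index_finsum_vec) (auto simp: V_vec_def)
    moreover have "finsum_vec TYPE('a fract) n (\<lambda>l. to_fract (H $$ (l, j)) \<cdot>\<^sub>v V_vec r n p K l) {..<s}
        \<in> carrier_vec n"
      using V by (intro finsum_vec_closed) auto
    ultimately have "z_vec r n p K H s j $ i = - (\<Sum>l<s. to_fract (H $$ (l, j)) * ?V l) + ?V j"
      using i V[of j] False by (simp add: z_vec_def)
    \<comment> \<open>Both summands are padded with zeros to sums over all \<open>k < f\<close>, so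
      that they merge into a single sum with the entries of column \<open>j\<close> as
      coefficients.\<close>
    also have "- (\<Sum>l<s. to_fract (H $$ (l, j)) * ?V l)
        = (\<Sum>k<f. if k < s then - to_fract (H $$ (k, j)) * ?V k else 0)"
      using assms unfolding sum_negf[symmetric] by (intro sum.mono_neutral_cong_left) auto
    also have "?V j = (\<Sum>k<f. if j = k then ?V k else 0)"
      using assms by simp
    also have "(\<Sum>k<f. if k < s then - to_fract (H $$ (k, j)) * ?V k else 0) + \<dots>
        = (\<Sum>k<f. to_fract (coeff_mat f p H s $$ (k, j)) * ?V k)"
      unfolding sum.distrib[symmetric] using False assms
      by (intro sum.cong) (auto simp: coeff_mat_def)
    finally show ?thesis unfolding rhs .
  qed
qed

text \<open>By linearity: exchanging the two sums turns a combination of the columns of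
  \<open>coeff_mat\<close> into a matrix-vector product.\<close>

lemma finsum_z_vec:
  assumes "s \<le> f"
  shows "(\<Oplus>\<^bsub>fract_module n\<^esub>j\<in>{..<f}. a j \<odot>\<^bsub>fract_module n\<^esub> z_vec r n p K H s j)
    = null_vec r n p K (coeff_mat f p H s *\<^sub>v vec f a)"
proof (rule eq_vecI)
  have z: "z_vec r n p K H s j = null_vec r n p K (col (coeff_mat f p H s) j)"
    "z_vec r n p K H s j \<in> carrier_vec n" if "j < f" for j
    using z_vec_eq_null_vec[OF that assms] by (auto simp: null_vec_def)
  let ?L = "\<Oplus>\<^bsub>fract_module n\<^esub>j\<in>{..<f}. a j \<odot>\<^bsub>fract_module n\<^esub> z_vec r n p K H s j"
  have L: "?L = finsum_vec TYPE('a fract) n (\<lambda>j. to_fract (a j) \<cdot>\<^sub>v z_vec r n p K H s j) {..<f}"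
    unfolding finsum_fract_module by (simp add: fract_module_def)
  have "?L \<in> carrier_vec n" unfolding L using z(2) by (intro finsum_vec_closed) auto
  then show "dim_vec ?L = dim_vec (null_vec r n p K (coeff_mat f p H s *\<^sub>v vec f a))"
    by (simp add: null_vec_def)
  fix i assume "i < dim_vec (null_vec r n p K (coeff_mat f p H s *\<^sub>v vec f a))"
  then have i: "i < n" by (simp add: null_vec_def)
  let ?V = "\<lambda>k. V_vec r n p K k $ i" and ?c = "\<lambda>k j. coeff_mat f p H s $$ (k, j)"
  have zi: "z_vec r n p K H s j $ i = (\<Sum>k<f. to_fract (?c k j) * ?V k)" if "j < f" for j
    unfolding z(1)[OF that] using null_vec_index[of "col (coeff_mat f p H s) j" i] i that
    by (simp add: coeff_mat_def)
  have "?L $ i = (\<Sum>j<f. (to_fract (a j) \<cdot>\<^sub>v z_vec r n p K H s j) $ i)"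
    unfolding L using i z(2) by (subst index_finsum_vec) auto
  also have "\<dots> = (\<Sum>j<f. to_fract (a j) * z_vec r n p K H s j $ i)"
    using i carrier_vecD[OF z(2)] by (intro sum.cong) auto
  also have "\<dots> = (\<Sum>j<f. \<Sum>k<f. to_fract (a j) * to_fract (?c k j) * ?V k)"
    by (simp add: zi sum_distrib_left mult.assoc)
  also have "\<dots> = (\<Sum>k<f. \<Sum>j<f. to_fract (a j) * to_fract (?c k j) * ?V k)"
    by (rule sum.swap)
  also have "\<dots> = (\<Sum>k<f. to_fract ((coeff_mat f p H s *\<^sub>v vec f a) $ k) * ?V k)"
    by (intro sum.cong) (auto simp: coeff_mat_def scalar_prod_def lessThan_atLeast0 to_fract_sum
        sum_distrib_left sum_distrib_right mult_ac)
  also have "\<dots> = null_vec r n p K (coeff_mat f p H s *\<^sub>v vec f a) $ i"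
    using i by (subst null_vec_index) (auto simp: coeff_mat_def intro: carrier_vecI)
  finally show "?L $ i = null_vec r n p K (coeff_mat f p H s *\<^sub>v vec f a) $ i" .
qed

section \<open>The block triangular coefficient matrix, with diagonal blocks \<open>p\<close> times
  the identity and the identity: injectivity and image\<close>

lemma coeff_mat_mult_vec:
  assumes "s \<le> f" "a \<in> carrier_vec f" "k < f"
  shows "(coeff_mat f p H s *\<^sub>v a) $ k
    = (if k < s then p * a $ k - (\<Sum>j=s..<f. H $$ (k, j) * a $ j) else a $ k)"
proof -
  have "(coeff_mat f p H s *\<^sub>v a) $ k = (\<Sum>j=0..<f. coeff_mat f p H s $$ (k, j) * a $ j)"
    using assms by (simp add: coeff_mat_def scalar_prod_def)
  also have "\<dots> = (\<Sum>j=0..<s. coeff_mat f p H s $$ (k, j) * a $ j)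
      + (\<Sum>j=s..<f. coeff_mat f p H s $$ (k, j) * a $ j)"
    using assms by (simp add: sum.atLeastLessThan_concat)
  also have "(\<Sum>j=0..<s. coeff_mat f p H s $$ (k, j) * a $ j)
      = (\<Sum>j=0..<s. if k = j then p * a $ j else 0)"
    using assms by (intro sum.cong) (auto simp: coeff_mat_def)
  also have "(\<Sum>j=s..<f. coeff_mat f p H s $$ (k, j) * a $ j)
      = (\<Sum>j=s..<f. if k < s then - (H $$ (k, j) * a $ j) else if k = j then a $ j else 0)"
    using assms by (intro sum.cong) (auto simp: coeff_mat_def)
  finally show ?thesis using assms by (cases "k < s") (simp_all add: sum_negf)
qed

text \<open>Back substitution: the entries from \<open>s\<close> on can be read off directly, and
  the remaining ones follow by cancelling \<open>p\<close>.\<close>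

lemma coeff_mat_mult_vec_inj:
  assumes "s \<le> f" "a \<in> carrier_vec f" "b \<in> carrier_vec f"
    and eq: "coeff_mat f p H s *\<^sub>v a = coeff_mat f p H s *\<^sub>v b"
  shows "a = b"
proof -
  have eq_k: "(coeff_mat f p H s *\<^sub>v a) $ k = (coeff_mat f p H s *\<^sub>v b) $ k" for k
    using eq by simp
  have ge: "a $ k = b $ k" if "s \<le> k" "k < f" for k
    using eq_k[of k] coeff_mat_mult_vec[of s] assms(1-3) that by simp
  have "a $ k = b $ k" if "k < s" for k
  proof -
    have "(\<Sum>j=s..<f. H $$ (k, j) * a $ j) = (\<Sum>j=s..<f. H $$ (k, j) * b $ j)"
      using ge by (intro sum.cong) auto
    then show ?thesis
      using eq_k[of k] coeff_mat_mult_vec[of s] assms(1-3) that p0 by simp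
  qed
  then show ?thesis using ge assms by (intro eq_vecI) (auto simp: not_less[symmetric])
qed

text \<open>Modulo \<open>p\<close>, \<open>H\<close> has unit vectors as its first \<open>s\<close>
  columns and zero rows from \<open>s\<close> on. Only the first \<open>s\<close> rows impose a
  condition on \<open>x\<close>, and dividing that condition by \<open>p\<close> recovers the
  coefficients.\<close>

lemma coeff_mat_range:
  assumes H: "H \<in> carrier_mat r f" and s: "s \<le> f" "s \<le> r"
    and pivot: "\<And>i j. i < r \<Longrightarrow> j < s \<Longrightarrow> p dvd H $$ (i, j) - (if i = j then 1 else 0)"
    and zero: "\<And>i j. s \<le> i \<Longrightarrow> i < r \<Longrightarrow> j < f \<Longrightarrow> p dvd H $$ (i, j)"
    and x: "x \<in> carrier_vec f"
  shows "(\<forall>i<r. p dvd (H *\<^sub>v x) $ i) \<longleftrightarrow> (\<exists>a. x = coeff_mat f p H s *\<^sub>v vec f a)"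
proof -
  have Hx: "(H *\<^sub>v x) $ i = (\<Sum>j=0..<f. H $$ (i, j) * x $ j)" if "i < r" for i
    using that H x by (simp add: scalar_prod_def)
  have low: "p dvd (H *\<^sub>v x) $ i" if "s \<le> i" "i < r" for i
    unfolding Hx[OF that(2)] using zero that by (intro dvd_sum dvd_mult2) auto
  have high: "p dvd (H *\<^sub>v x) $ i \<longleftrightarrow> p dvd x $ i + (\<Sum>j=s..<f. H $$ (i, j) * x $ j)"
    if "i < s" for i
  proof -
    \<comment> \<open>The leading columns of \<open>H\<close> are unit vectors only modulo
      \<open>p\<close>, so they contribute \<open>x $ i\<close> up to a multiple of
      \<open>p\<close>.\<close>
    have "(\<Sum>j=0..<s. H $$ (i, j) * x $ j) - x $ i
        = (\<Sum>j=0..<s. H $$ (i, j) * x $ j) - (\<Sum>j=0..<s. if i = j then x $ j else 0)"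
      using that by simp
    also have "\<dots> = (\<Sum>j=0..<s. (H $$ (i, j) - (if i = j then 1 else 0)) * x $ j)"
      unfolding sum_subtractf[symmetric] by (intro sum.cong) (auto simp: left_diff_distrib)
    also have "p dvd \<dots>"
      using pivot that s by (intro dvd_sum dvd_mult2) auto
    finally have "p dvd (\<Sum>j=0..<s. H $$ (i, j) * x $ j) - x $ i" .
    moreover have "(H *\<^sub>v x) $ i = ((\<Sum>j=0..<s. H $$ (i, j) * x $ j) - x $ i)
        + (x $ i + (\<Sum>j=s..<f. H $$ (i, j) * x $ j))"
      using Hx[of i] that s by (simp add: sum.atLeastLessThan_concat)
    ultimately show ?thesis by (simp only: dvd_add_right_iff)
  qed
  show ?thesis
  proof
    assume dvd: "\<forall>i<r. p dvd (H *\<^sub>v x) $ i"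
    then have "\<forall>i<s. \<exists>c. x $ i + (\<Sum>j=s..<f. H $$ (i, j) * x $ j) = p * c"
      using high s unfolding dvd_def by auto
    then obtain c where c: "\<And>i. i < s \<Longrightarrow> x $ i + (\<Sum>j=s..<f. H $$ (i, j) * x $ j) = p * c i"
      by metis
    \<comment> \<open>The quotients by \<open>p\<close> are the coefficients of the first
      \<open>s\<close> generators; the other coefficients are the entries of \<open>x\<close>
      themselves.\<close>
    define a where "a = (\<lambda>k. if k < s then c k else x $ k)"
    have "x $ k = (coeff_mat f p H s *\<^sub>v vec f a) $ k" if "k < f" for k
      using that s c[of k] by (auto simp: coeff_mat_mult_vec a_def algebra_simps)
    then have "x = coeff_mat f p H s *\<^sub>v vec f a"
      using x by (intro eq_vecI) (auto simp: coeff_mat_def)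
    then show "\<exists>a. x = coeff_mat f p H s *\<^sub>v vec f a" by blast
  next
    assume "\<exists>a. x = coeff_mat f p H s *\<^sub>v vec f a"
    then obtain a where a: "x = coeff_mat f p H s *\<^sub>v vec f a" by blast
    \<comment> \<open>From index \<open>s\<close> on, \<open>x\<close> agrees with \<open>a\<close>,
      so the two sums cancel and \<open>p * a i\<close> remains.\<close>
    have "p dvd x $ i + (\<Sum>j=s..<f. H $$ (i, j) * x $ j)" if "i < s" for i
    proof -
      have "(\<Sum>j=s..<f. H $$ (i, j) * x $ j) = (\<Sum>j=s..<f. H $$ (i, j) * a j)"
        using s by (intro sum.cong) (auto simp: a coeff_mat_mult_vec)
      moreover have "x $ i = p * a i - (\<Sum>j=s..<f. H $$ (i, j) * a j)"
        using that s by (simp add: a coeff_mat_mult_vec)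
      ultimately show ?thesis by simp
    qed
    then show "\<forall>i<r. p dvd (H *\<^sub>v x) $ i"
      using high low by (metis not_less)
  qed
qed

end


section \<open>Assembly: parametrization of the null space and uniqueness of the parameters\<close>

theorem theorem7p1:
  fixes p :: "'a::idom"
    and K H :: "'a mat"
    and r n f s :: nat
  assumes "principal_domain (class_ring :: 'a ring)"
    and "0 < r" and "r < n" and "f = n - r"
    and "prime_elem p"
    and "K \<in> carrier_mat r f"
    and "s = rank_over (quot_by p) (reduce_mat p K)"
    and "H \<in> carrier_mat r f"
    and "is_rref_of (quot_by p) (reduce_mat p H) (reduce_mat p K)"
    and "leading_columns (quot_by p) (reduce_mat p H) = {..<s}"
  shows "basis_of_submodule (class_ring :: 'a ring) (fract_module n)
           (map_vec to_fract ` null_space r n p K) {..<f} (z_vec r n p K H s)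
         \<and> (s = 0 \<longrightarrow> z_vec r n p K H s ` {..<f} = V_vec r n p K ` {..<f})"
proof (intro conjI impI)
  let ?Q = "quot_by p" and ?h = "(+>\<^bsub>class_ring\<^esub>) (PIdl\<^bsub>class_ring\<^esub> p)"
  interpret h: ring_hom_cring class_ring ?Q ?h by (rule quot_by_hom)
  interpret M: Module.module "class_ring :: 'a ring" "fract_module n" by (rule module_fract_module)
  have n: "n = r + f" using assms by simp
  have p0: "p \<noteq> 0" using assms by auto
  note K = \<open>K \<in> carrier_mat r f\<close> and H = \<open>H \<in> carrier_mat r f\<close>
  note params = n p0 K
  have rref: "reduced_row_echelon ?Q (reduce_mat p H)"
    and equiv: "row_equivalent_over ?Q (reduce_mat p K) (reduce_mat p H)"
    using assms unfolding is_rref_of_def by auto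
  note cols = \<open>leading_columns ?Q (reduce_mat p H) = {..<s}\<close>
  \<comment> \<open>The diagonal leading entries must lie inside the matrix, which bounds
    \<open>s\<close> by both dimensions.\<close>
  have "i < r \<and> i < f" if "i < s" for i
    using leading_entry_diag[OF rref cols that] H
    unfolding leading_entry_def by (auto simp: reduce_mat_def)
  then have s: "s \<le> f" "s \<le> r" by (meson not_le order_refl)+
  have pivot: "p dvd H $$ (i, j) - (if i = j then 1 else 0)" if "i < r" "j < s" for i j
    using rref_pivot_column[OF rref cols that(2), of i] h.hom_one h.hom_zero that s H
    by (auto simp: reduce_mat_def simp flip: coset_eq_iff_dvd_diff)
  have zero: "p dvd H $$ (i, j)" if "s \<le> i" "i < r" "j < f" for i j
    using rref_zero_row[OF rref cols that(1), of j] h.hom_zero that H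
      coset_eq_iff_dvd_diff[of p "H $$ (i, j)" 0]
    by (auto simp: reduce_mat_def)
  \<comment> \<open>Integrality is passed from \<open>K\<close> to \<open>H\<close> by row
    equivalence and then solved by the image of \<open>coeff_mat\<close>; the parameter
    \<open>a\<close> is an arbitrary family in R.\<close>
  have N: "map_vec to_fract ` null_space r n p K
      = {null_vec r n p K (coeff_mat f p H s *\<^sub>v vec f a) |a. True}"
  proof -
    have "coeff_mat f p H s *\<^sub>v vec f a \<in> carrier_vec f" for a
      by (intro carrier_vecI) (simp add: coeff_mat_def)
    then show ?thesis
      unfolding image_null_space[OF params]
      using row_equivalent_kernel_iff[OF equiv K H] coeff_mat_range[OF params H s pivot zero]
      by blast
  qed
  show "basis_of_submodule class_ring (fract_module n)
      (map_vec to_fract ` null_space r n p K) {..<f} (z_vec r n p K H s)"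
  proof (rule M.basis_of_submodule_if_unique_coeffs)
    show "z_vec r n p K H s \<in> {..<f} \<rightarrow> carrier (fract_module n)"
      using z_vec_eq_null_vec[OF params _ s(1)]
      by (auto simp: fract_module_def null_vec_def)
    show "map_vec to_fract ` null_space r n p K
      = {\<Oplus>\<^bsub>fract_module n\<^esub>j\<in>{..<f}. a j \<odot>\<^bsub>fract_module n\<^esub> z_vec r n p K H s j |a.
          a \<in> {..<f} \<rightarrow> carrier class_ring}"
      unfolding N finsum_z_vec[OF params s(1)] by simp
  next
    fix a b i
    assume eq: "(\<Oplus>\<^bsub>fract_module n\<^esub>j\<in>{..<f}. a j \<odot>\<^bsub>fract_module n\<^esub> z_vec r n p K H s j)
      = (\<Oplus>\<^bsub>fract_module n\<^esub>j\<in>{..<f}. b j \<odot>\<^bsub>fract_module n\<^esub> z_vec r n p K H s j)"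
      and i: "i \<in> {..<f}"
    \<comment> \<open>Uniqueness is obtained by undoing two injective maps in turn,
      \<open>null_vec\<close> and then \<open>coeff_mat\<close>.\<close>
    have "coeff_mat f p H s *\<^sub>v vec f a = coeff_mat f p H s *\<^sub>v vec f b"
      using eq unfolding finsum_z_vec[OF params s(1)]
      by (subst (asm) null_vec_eq_iff[OF params]) (auto simp: coeff_mat_def intro: carrier_vecI)
    then have "vec f a = vec f b"
      by (rule coeff_mat_mult_vec_inj[OF params s(1), rotated 2]) auto
    then show "a i = b i" using i by (metis index_vec lessThan_iff)
  qed simp_all
  \<comment> \<open>With no leading columns, the sum subtracted in each generator is empty.\<close>
  show "z_vec r n p K H s ` {..<f} = V_vec r n p K ` {..<f}" if "s = 0"
    using that by (auto simp: z_vec_def finsum_vec_empty V_vec_def)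
qed

end
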